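(* Let $\mathfrak{a}$ be the six-dimensional abelian Lie algebra, let $\mathfrak{n}_1=(0,0,0,0,e^{12},e^{34})$ and $\mathfrak{n}_2=(0,0,0,0,e^{13}-e^{24},e^{14}+e^{23})$. (i) If $\mathfrak{n}$ is $\mathfrak{a}$ or $\mathfrak{n}_1$ and $D\in\mathrm{Der}(\mathfrak{n})$ is any derivation, then the seven-dimensional solvable Lie algebra $\mathfrak{g}=\mathfrak{n}\rtimes_D\mathbb{R}$ does not admit any exact $\mathrm{G}_2$-structure. (ii) If $D\in\mathrm{Der}(\mathfrak{n}_2)$ is such that $\mathfrak{g}=\mathfrak{n}_2\rtimes_D\mathbb{R}$ is strongly unimodular, then $\mathfrak{g}$ does not admit any exact $\mathrm{G}_2$-structure.
   Context: All Lie algebras are real and finite-dimensional. For a Lie algebra $\mathfrak{g}$, $d$ denotes the Chevalley-Eilenberg differential on $\Lambda^\bullet(\mathfrak{g}^* )$, given on 1-forms by $d\alpha(X,Y)=-\alpha([X,Y])$. Notation for nilpotent Lie algebras: $(0,0,0,0,e^{12},e^{34})$ denotes the six-dimensional Lie algebra having a basis whose dual basis $(e^1,\dots,e^6)$ satisfies $de^1=\dots=de^4=0$, $de^5=e^{12}$, $de^6=e^{34}$, where $e^{ij}=e^i\wedge e^j$; similarly, $(0,0,0,0,e^{13}-e^{24},e^{14}+e^{23})$ is the one with $de^1=\dots=de^4=0$, $de^5=e^{13}-e^{24}$, $de^6=e^{14}+e^{23}$. For a Lie algebra $\mathfrak{n}$ and $D\in\mathrm{Der}(\mathfrak{n})$,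 $\mathfrak{n}\rtimes_D\mathbb{R}$ is the Lie algebra with underlying vector space $\mathfrak{n}\oplus\langle e_7\rangle$ containing $\mathfrak{n}$ as an ideal with its given bracket, and with $[e_7,X]=D(X)$ for $X\in\mathfrak{n}$. A $\mathrm{G}_2$-structure on a seven-dimensional Lie algebra $\mathfrak{g}$ is a 3-form $\phi\in\Lambda^3(\mathfrak{g}^* )$ such that $\iota_v\phi\wedge\iota_v\phi\wedge\phi\neq 0\in\Lambda^7(\mathfrak{g}^* )$ for all $v\in\mathfrak{g}\smallsetminus\{0\}$, where $\iota_v$ denotes contraction by $v$. It is exact if $\phi=d\alpha$ for some $\alpha\in\Lambda^2(\mathfrak{g}^* )$. A solvable Lie algebra $\mathfrak{g}$ with nilradical $\mathfrak{m}$ is strongly unimodular if, setting $\mathfrak{m}^{0}=\mathfrak{m}$ and $\mathfrak{m}^{i}=[\mathfrak{m},\mathfrak{m}^{i-1}]$ for $i\ge 1$, for every $X\in\mathfrak{g}$ and every $i\geq 0$ the endomorphism of $\mathfrak{m}^{i}/\mathfrak{m}^{i+1}$ induced by $\mathrm{ad}_X$ is traceless. *)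

theory Defs
  imports "HOL-Analysis.Analysis"
begin

section \<open>Lie algebras\<close>

text \<open>
  A real finite-dimensional Lie algebra is a bracket on a type of class
  \<^class>\<open>euclidean_space\<close>. The class only supplies finite dimensionality; the inner
  product plays no role.
\<close>

definition lie_algebra :: "('a::euclidean_space \<Rightarrow> 'a \<Rightarrow> 'a) \<Rightarrow> bool" where
  "lie_algebra br \<longleftrightarrow>
     bilinear br \<and> (\<forall>x. br x x = 0) \<and>
     (\<forall>x y z. br x (br y z) + br y (br z x) + br z (br x y) = 0)"

definition derivation :: "('a::euclidean_space \<Rightarrow> 'a \<Rightarrow> 'a) \<Rightarrow> ('a \<Rightarrow> 'a) \<Rightarrow> bool" where
  "derivation br D \<longleftrightarrow> linear D \<and> (\<forall>x y. D (br x y) = br (D x) y + br x (D y))"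

text \<open>
  The pair \<open>(x, s)\<close> stands for \<open>x + s e\<^sub>7\<close>, so that \<open>[e\<^sub>7, x] = D x\<close>.
\<close>

definition semidirect ::
  "('a::euclidean_space \<Rightarrow> 'a \<Rightarrow> 'a) \<Rightarrow> ('a \<Rightarrow> 'a) \<Rightarrow> 'a \<times> real \<Rightarrow> 'a \<times> real \<Rightarrow> 'a \<times> real" where
  "semidirect br D = (\<lambda>(x, s) (y, t). (br x y + s *\<^sub>R D y - t *\<^sub>R D x, 0))"

definition bracket_span ::
  "('a::euclidean_space \<Rightarrow> 'a \<Rightarrow> 'a) \<Rightarrow> 'a set \<Rightarrow> 'a set \<Rightarrow> 'a set" where
  "bracket_span br A B = span {br x y | x y. x \<in> A \<and> y \<in> B}"

primrec lower_central :: "('a::euclidean_space \<Rightarrow> 'a \<Rightarrow> 'a) \<Rightarrow> 'a set \<Rightarrow> nat \<Rightarrow> 'a set" where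
  "lower_central br m 0 = m"
| "lower_central br m (Suc i) = bracket_span br m (lower_central br m i)"

primrec derived_series :: "('a::euclidean_space \<Rightarrow> 'a \<Rightarrow> 'a) \<Rightarrow> nat \<Rightarrow> 'a set" where
  "derived_series br 0 = UNIV"
| "derived_series br (Suc i) = bracket_span br (derived_series br i) (derived_series br i)"

definition solvable :: "('a::euclidean_space \<Rightarrow> 'a \<Rightarrow> 'a) \<Rightarrow> bool" where
  "solvable br \<longleftrightarrow> (\<exists>k. derived_series br k = {0})"

definition lie_ideal :: "('a::euclidean_space \<Rightarrow> 'a \<Rightarrow> 'a) \<Rightarrow> 'a set \<Rightarrow> bool" where
  "lie_ideal br I \<longleftrightarrow> subspace I \<and> (\<forall>x. \<forall>y\<in>I. br x y \<in> I)"

definition nilpotent_ideal :: "('a::euclidean_space \<Rightarrow> 'a \<Rightarrow> 'a) \<Rightarrow> 'a set \<Rightarrow> bool" where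
  "nilpotent_ideal br I \<longleftrightarrow> lie_ideal br I \<and> (\<exists>k. lower_central br I k = {0})"

definition is_nilradical :: "('a::euclidean_space \<Rightarrow> 'a \<Rightarrow> 'a) \<Rightarrow> 'a set \<Rightarrow> bool" where
  "is_nilradical br m \<longleftrightarrow> nilpotent_ideal br m \<and> (\<forall>I. nilpotent_ideal br I \<longrightarrow> I \<subseteq> m)"

section \<open>Traces on quotients\<close>

text \<open>
  \<open>basis_mod C U W\<close> says that the cosets \<open>c + W\<close>, for \<open>c\<close> in \<open>C\<close>, are pairwise distinct and
  form a basis of \<open>U/W\<close>; \<open>coord_mod C W u\<close> are the coordinates of \<open>u + W\<close> in this basis.
  The value of \<open>quotient_trace\<close> does not depend on the chosen basis, see
  \<open>quotient_trace_eq\<close> below.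
\<close>

definition basis_mod :: "'a::euclidean_space set \<Rightarrow> 'a set \<Rightarrow> 'a set \<Rightarrow> bool" where
  "basis_mod C U W \<longleftrightarrow> finite C \<and> C \<subseteq> U \<and>
     (\<forall>u\<in>U. \<exists>!a. (\<forall>c. c \<notin> C \<longrightarrow> a c = 0) \<and> u - (\<Sum>c\<in>C. a c *\<^sub>R c) \<in> W)"

definition coord_mod :: "'a::euclidean_space set \<Rightarrow> 'a set \<Rightarrow> 'a \<Rightarrow> 'a \<Rightarrow> real" where
  "coord_mod C W u = (THE a. (\<forall>c. c \<notin> C \<longrightarrow> a c = 0) \<and> u - (\<Sum>c\<in>C. a c *\<^sub>R c) \<in> W)"

definition quotient_trace ::
  "('a::euclidean_space \<Rightarrow> 'a) \<Rightarrow> 'a set \<Rightarrow> 'a set \<Rightarrow> real" where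
  "quotient_trace f U W =
     (let C = SOME C. basis_mod C U W in \<Sum>c\<in>C. coord_mod C W (f c) c)"

definition strongly_unimodular :: "('a::euclidean_space \<Rightarrow> 'a \<Rightarrow> 'a) \<Rightarrow> bool" where
  "strongly_unimodular br \<longleftrightarrow> solvable br \<and>
     (\<exists>m. is_nilradical br m \<and>
       (\<forall>x i. quotient_trace (br x) (lower_central br m i) (lower_central br m (Suc i)) = 0))"

section \<open>Exterior forms\<close>

text \<open>
  A \<open>k\<close>-form is an alternating \<open>k\<close>-linear function of a list of \<open>k\<close> vectors, extended by \<open>0\<close>
  to lists of other lengths, so that equality of forms is equality of functions.
\<close>

definition alternating_form :: "nat \<Rightarrow> ('a::euclidean_space list \<Rightarrow> real) \<Rightarrow> bool" where
  "alternating_form k \<omega> \<longleftrightarrow>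
     (\<forall>vs. length vs \<noteq> k \<longrightarrow> \<omega> vs = 0) \<and>
     (\<forall>vs i. length vs = k \<longrightarrow> i < k \<longrightarrow> linear (\<lambda>x. \<omega> (vs[i := x]))) \<and>
     (\<forall>vs i j. length vs = k \<longrightarrow> i < j \<longrightarrow> j < k \<longrightarrow> vs ! i = vs ! j \<longrightarrow> \<omega> vs = 0)"

text \<open>
  Determinant convention: for 1-forms, the wedge product takes \<open>(x, y)\<close> to
  \<open>\<alpha> x * \<beta> y - \<alpha> y * \<beta> x\<close>. The degrees \<open>k\<close> and \<open>l\<close> of the factors are explicit.
\<close>

definition wedge ::
  "nat \<Rightarrow> nat \<Rightarrow> ('a::euclidean_space list \<Rightarrow> real) \<Rightarrow> ('a list \<Rightarrow> real) \<Rightarrow> 'a list \<Rightarrow> real" where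
  "wedge k l \<omega> \<eta> vs =
     (if length vs = k + l then
        (\<Sum>p | p permutes {..<k + l}.
           of_int (sign p) * \<omega> (map (\<lambda>i. vs ! p i) [0..<k]) * \<eta> (map (\<lambda>i. vs ! p i) [k..<k + l]))
        / (fact k * fact l)
      else 0)"

definition contraction ::
  "'a::euclidean_space \<Rightarrow> ('a list \<Rightarrow> real) \<Rightarrow> 'a list \<Rightarrow> real" where
  "contraction v \<omega> vs = \<omega> (v # vs)"

text \<open>
  The usual formula
  \<open>d\<omega>(x\<^sub>0, \<dots>, x\<^sub>k) = \<Sum>\<^sub>i\<^sub><\<^sub>j (-1)\<^sup>i\<^sup>+\<^sup>j \<omega>([x\<^sub>i, x\<^sub>j], x\<^sub>0, \<dots>, x\<^sub>k)\<close>, where the arguments \<open>x\<^sub>i\<close> and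
  \<open>x\<^sub>j\<close> are omitted from the tail on the right.
\<close>

definition ce_d ::
  "('a::euclidean_space \<Rightarrow> 'a \<Rightarrow> 'a) \<Rightarrow> ('a list \<Rightarrow> real) \<Rightarrow> 'a list \<Rightarrow> real" where
  "ce_d br \<omega> vs =
     (\<Sum>j<length vs. \<Sum>i<j. (-1) ^ (i + j) * \<omega> (br (vs ! i) (vs ! j) # nths vs (- {i, j})))"

section \<open>Structure equations\<close>

definition dual_bases ::
  "nat \<Rightarrow> (nat \<Rightarrow> 'a::euclidean_space) \<Rightarrow> (nat \<Rightarrow> 'a list \<Rightarrow> real) \<Rightarrow> bool" where
  "dual_bases n b e \<longleftrightarrow>
     inj_on b {1..n} \<and> independent (b ` {1..n}) \<and> span (b ` {1..n}) = UNIV \<and>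
     (\<forall>i\<in>{1..n}. alternating_form 1 (e i)) \<and>
     (\<forall>i\<in>{1..n}. \<forall>j\<in>{1..n}. e i [b j] = (if i = j then 1 else 0))"

definition abelian :: "('a::euclidean_space \<Rightarrow> 'a \<Rightarrow> 'a) \<Rightarrow> bool" where
  "abelian br \<longleftrightarrow> (\<forall>x y. br x y = 0)"

text \<open>\<open>br\<close> is a Lie algebra \<open>(0,0,0,0,e\<^sup>1\<^sup>2,e\<^sup>3\<^sup>4)\<close>.\<close>

definition is_n1 :: "('a::euclidean_space \<Rightarrow> 'a \<Rightarrow> 'a) \<Rightarrow> bool" where
  "is_n1 br \<longleftrightarrow> lie_algebra br \<and>
     (\<exists>b e. dual_bases 6 b e \<and>
        (\<forall>i\<in>{1..4}. ce_d br (e i) = (\<lambda>_. 0)) \<and>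
        ce_d br (e 5) = wedge 1 1 (e 1) (e 2) \<and>
        ce_d br (e 6) = wedge 1 1 (e 3) (e 4))"

text \<open>\<open>br\<close> is a Lie algebra \<open>(0,0,0,0,e\<^sup>1\<^sup>3-e\<^sup>2\<^sup>4,e\<^sup>1\<^sup>4+e\<^sup>2\<^sup>3)\<close>.\<close>

definition is_n2 :: "('a::euclidean_space \<Rightarrow> 'a \<Rightarrow> 'a) \<Rightarrow> bool" where
  "is_n2 br \<longleftrightarrow> lie_algebra br \<and>
     (\<exists>b e. dual_bases 6 b e \<and>
        (\<forall>i\<in>{1..4}. ce_d br (e i) = (\<lambda>_. 0)) \<and>
        ce_d br (e 5) = (\<lambda>vs. wedge 1 1 (e 1) (e 3) vs - wedge 1 1 (e 2) (e 4) vs) \<and>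
        ce_d br (e 6) = (\<lambda>vs. wedge 1 1 (e 1) (e 4) vs + wedge 1 1 (e 2) (e 3) vs))"

section \<open>Exact G2-structures\<close>

definition G2_structure :: "('a::euclidean_space list \<Rightarrow> real) \<Rightarrow> bool" where
  "G2_structure \<phi> \<longleftrightarrow> DIM('a) = 7 \<and> alternating_form 3 \<phi> \<and>
     (\<forall>v. v \<noteq> 0 \<longrightarrow>
        wedge 4 3 (wedge 2 2 (contraction v \<phi>) (contraction v \<phi>)) \<phi> \<noteq> (\<lambda>_. 0))"

definition exact_G2_structure ::
  "('a::euclidean_space \<Rightarrow> 'a \<Rightarrow> 'a) \<Rightarrow> ('a list \<Rightarrow> real) \<Rightarrow> bool" where
  "exact_G2_structure br \<phi> \<longleftrightarrow>
     G2_structure \<phi> \<and> (\<exists>\<alpha>. alternating_form 2 \<alpha> \<and> \<phi> = ce_d br \<alpha>)"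

section \<open>Consistency of the definitions\<close>

lemma lie_algebra_semidirect:
  assumes "lie_algebra br" "derivation br D"
  shows "lie_algebra (semidirect br D)"
proof -
  have bil: "bilinear br" and alt: "\<And>x. br x x = 0"
    and jac: "\<And>x y z. br x (br y z) + br y (br z x) + br z (br x y) = 0"
    using assms(1) by (auto simp: lie_algebra_def)
  have lin: "linear D" and der: "\<And>x y. D (br x y) = br (D x) y + br x (D y)"
    using assms(2) by (auto simp: derivation_def)
  note bs = bilinear_ladd[OF bil] bilinear_radd[OF bil] bilinear_lsub[OF bil]
    bilinear_rsub[OF bil] bilinear_lmul[OF bil] bilinear_rmul[OF bil]
  note ds = linear_add[OF lin] linear_diff[OF lin] linear_cmul[OF lin]
  have skew: "br y x = - br x y" for x y
    using alt[of "x + y"] alt[of x] alt[of y] bs by (simp add: add_eq_0_iff2)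
  have "bilinear (semidirect br D)"
    unfolding bilinear_def
    by (auto intro!: linearI simp: semidirect_def bs ds algebra_simps)
  moreover have "semidirect br D x (semidirect br D y z) + semidirect br D y (semidirect br D z x)
      + semidirect br D z (semidirect br D x y) = 0" for x y z
  proof -
    obtain x1 r y1 s z1 t where [simp]: "x = (x1, r)" "y = (y1, s)" "z = (z1, t)"
      by (metis surj_pair)
    have "semidirect br D x (semidirect br D y z) + semidirect br D y (semidirect br D z x)
        + semidirect br D z (semidirect br D x y)
        = (br x1 (br y1 z1) + br y1 (br z1 x1) + br z1 (br x1 y1), 0)"
      by (simp add: semidirect_def bs ds der skew[of "D x1" y1] skew[of "D x1" z1]
          skew[of "D y1" x1] skew[of "D y1" z1] skew[of "D z1" x1] skew[of "D z1" y1] algebra_simps)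
    then show ?thesis
      by (simp only: jac zero_prod_def)
  qed
  ultimately show ?thesis
    by (auto simp: lie_algebra_def semidirect_def alt zero_prod_def)
qed

lemma ce_d_1: "ce_d br \<alpha> [x, y] = - \<alpha> [br x y]"
  by (simp add: ce_d_def lessThan_Suc nths_Cons)

lemma ce_d_2: "ce_d br \<alpha> [x, y, z] = - \<alpha> [br x y, z] + \<alpha> [br x z, y] - \<alpha> [br y z, x]"
  by (simp add: ce_d_def lessThan_Suc nths_Cons)

lemma wedge_1_1: "wedge 1 1 \<alpha> \<beta> [x, y] = \<alpha> [x] * \<beta> [y] - \<alpha> [y] * \<beta> [x]"
proof -
  have two: "{..<2::nat} = {0, 1}" by auto
  have "{p. p permutes {..<2::nat}} = {id, Transposition.transpose 0 1}"
    unfolding two by (auto simp: permutes_doubleton_iff)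
  moreover have "id \<noteq> Transposition.transpose (0::nat) 1"
    by (metis id_apply transpose_apply_first zero_neq_one)
  ultimately show ?thesis
    by (simp add: wedge_def sign_id sign_swap_id numeral_2_eq_2)
qed

lemma basis_mod_exists:
  assumes U: "subspace U" and W: "subspace W" and WU: "W \<subseteq> U"
  shows "\<exists>C. basis_mod C U W"
proof -
  obtain B where B: "B \<subseteq> W" "independent B" "W \<subseteq> span B"
    using maximal_independent_subset by blast
  obtain B' where B': "B \<subseteq> B'" "B' \<subseteq> U" "independent B'" "U \<subseteq> span B'"
    using maximal_independent_subset_extend[of B U] B WU by blast
  have fin: "finite B'" using B'(3) independent_imp_finite by blast
  define C where "C = B' - B"
  have finC: "finite C" using fin by (simp add: C_def)
  have Weq: "W = span B" using B W by (simp add: span_minimal subset_antisym)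
  have rep_C: "representation B' (\<Sum>c\<in>C. a c *\<^sub>R c) d = a d" if "d \<in> C" for a d
  proof -
    have cB: "c \<in> span B'" if "c \<in> C" for c using that by (simp add: C_def span_base)
    have "representation B' (\<Sum>c\<in>C. a c *\<^sub>R c) d = (\<Sum>c\<in>C. a c * representation B' c d)"
      using cB by (simp add: representation_sum[OF B'(3)] representation_scale[OF B'(3)] span_mul)
    also have "\<dots> = (\<Sum>c\<in>C. if c = d then a c else 0)"
      by (rule sum.cong) (auto simp: C_def representation_basis[OF B'(3)])
    finally show ?thesis using that finC by simp
  qed
  have rep_W: "representation B' w d = 0" if "w \<in> W" "d \<in> C" for w d
    using that representation_extend[OF B'(3), of w B] B'(1) representation_ne_zero[of B w d]
    by (auto simp: Weq C_def)
  have "\<exists>!a. (\<forall>c. c \<notin> C \<longrightarrow> a c = 0) \<and> u - (\<Sum>c\<in>C. a c *\<^sub>R c) \<in> W" if u: "u \<in> U" for u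
  proof (rule ex1I)
    let ?a = "\<lambda>c. if c \<in> C then representation B' u c else 0"
    have "u = (\<Sum>b\<in>B'. representation B' u b *\<^sub>R b)"
      using sum_representation_eq[OF B'(3) _ fin, of u] u B'(4) by auto
    also have "\<dots> = (\<Sum>b\<in>C. representation B' u b *\<^sub>R b) + (\<Sum>b\<in>B. representation B' u b *\<^sub>R b)"
      unfolding C_def using sum.subset_diff[OF B'(1) fin] by blast
    finally have "u - (\<Sum>c\<in>C. ?a c *\<^sub>R c) = (\<Sum>b\<in>B. representation B' u b *\<^sub>R b)"
      by (simp add: algebra_simps)
    then show "(\<forall>c. c \<notin> C \<longrightarrow> ?a c = 0) \<and> u - (\<Sum>c\<in>C. ?a c *\<^sub>R c) \<in> W"
      unfolding Weq by (simp add: span_sum span_mul span_base)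
    fix a assume a: "(\<forall>c. c \<notin> C \<longrightarrow> a c = 0) \<and> u - (\<Sum>c\<in>C. a c *\<^sub>R c) \<in> W"
    have sC: "(\<Sum>c\<in>C. a c *\<^sub>R c) \<in> span B'"
      by (intro span_sum span_mul span_base) (auto simp: C_def)
    have "representation B' u c = a c" if c: "c \<in> C" for c
    proof -
      have "representation B' (u - (\<Sum>c\<in>C. a c *\<^sub>R c)) c
          = representation B' u c - representation B' (\<Sum>c\<in>C. a c *\<^sub>R c) c"
        using representation_diff[OF B'(3) sC, of u] representation_diff[OF B'(3) _ sC, of u] u B'(4)
        by (auto dest: subsetD)
      then show ?thesis using rep_W[OF conjunct2[OF a] c] rep_C[OF c] by simp
    qed
    then show "a = ?a" using a by auto
  qed
  moreover have "C \<subseteq> U" using B'(2) by (auto simp: C_def)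
  ultimately have "basis_mod C U W"
    using finC by (simp add: basis_mod_def)
  then show ?thesis ..
qed

lemma coord_mod:
  assumes "basis_mod C U W" "u \<in> U"
  shows "c \<notin> C \<Longrightarrow> coord_mod C W u c = 0"
    and "u - (\<Sum>c\<in>C. coord_mod C W u c *\<^sub>R c) \<in> W"
proof -
  have "\<exists>!a. (\<forall>c. c \<notin> C \<longrightarrow> a c = 0) \<and> u - (\<Sum>c\<in>C. a c *\<^sub>R c) \<in> W"
    using assms by (auto simp: basis_mod_def)
  from theI'[OF this] show "c \<notin> C \<Longrightarrow> coord_mod C W u c = 0"
    and "u - (\<Sum>c\<in>C. coord_mod C W u c *\<^sub>R c) \<in> W"
    by (auto simp: coord_mod_def)
qed

lemma coord_mod_unique:
  assumes "basis_mod C U W" "u \<in> U" "\<And>c. c \<notin> C \<Longrightarrow> a c = 0"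
    and "u - (\<Sum>c\<in>C. a c *\<^sub>R c) \<in> W"
  shows "coord_mod C W u = a"
proof -
  have "\<exists>!a. (\<forall>c. c \<notin> C \<longrightarrow> a c = 0) \<and> u - (\<Sum>c\<in>C. a c *\<^sub>R c) \<in> W"
    using assms by (auto simp: basis_mod_def)
  then show ?thesis
    unfolding coord_mod_def by (rule the1_equality) (use assms in auto)
qed

lemma coord_mod_comb:
  assumes C: "basis_mod C U W" and U: "subspace U" and W: "subspace W" and "finite S"
    and g: "\<And>s. s \<in> S \<Longrightarrow> g s \<in> U" and u: "u \<in> U" "u - (\<Sum>s\<in>S. k s *\<^sub>R g s) \<in> W"
  shows "coord_mod C W u c = (\<Sum>s\<in>S. k s * coord_mod C W (g s) c)"
proof -
  let ?a = "\<lambda>c. \<Sum>s\<in>S. k s * coord_mod C W (g s) c"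
  have "(\<Sum>s\<in>S. k s *\<^sub>R (g s - (\<Sum>c\<in>C. coord_mod C W (g s) c *\<^sub>R c))) \<in> W"
    using coord_mod(2)[OF C g] W by (intro subspace_sum subspace_scale) auto
  then have "(u - (\<Sum>s\<in>S. k s *\<^sub>R g s)) + (\<Sum>s\<in>S. k s *\<^sub>R (g s - (\<Sum>c\<in>C. coord_mod C W (g s) c *\<^sub>R c))) \<in> W"
    using u(2) W subspace_add by blast
  also have "(u - (\<Sum>s\<in>S. k s *\<^sub>R g s)) + (\<Sum>s\<in>S. k s *\<^sub>R (g s - (\<Sum>c\<in>C. coord_mod C W (g s) c *\<^sub>R c)))
      = u - (\<Sum>s\<in>S. \<Sum>c\<in>C. (k s * coord_mod C W (g s) c) *\<^sub>R c)"
    by (simp add: scaleR_diff_right sum_subtractf scaleR_sum_right)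
  also have "\<dots> = u - (\<Sum>c\<in>C. ?a c *\<^sub>R c)"
    by (subst sum.swap) (simp add: scaleR_sum_left)
  finally have "coord_mod C W u = ?a"
    using coord_mod(1)[OF C g] by (intro coord_mod_unique[OF C u(1)]) auto
  then show ?thesis by simp
qed

text \<open>The trace may be computed in any basis of the quotient.\<close>

lemma quotient_trace_eq:
  assumes C: "basis_mod C U W" and U: "subspace U" and W: "subspace W"
    and f: "linear f" "f ` U \<subseteq> U" "f ` W \<subseteq> W"
  shows "quotient_trace f U W = (\<Sum>c\<in>C. coord_mod C W (f c) c)"
proof -
  define B where "B = (SOME C. basis_mod C U W)"
  have B: "basis_mod B U W" unfolding B_def using C by (rule someI)
  have fin: "finite B" "finite C" and sub: "B \<subseteq> U" "C \<subseteq> U"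
    using B C by (auto simp: basis_mod_def)
  have im: "coord_mod B W (f c) b = (\<Sum>b'\<in>B. coord_mod B W c b' * coord_mod B W (f b') b)"
    if c: "c \<in> C" for b c
  proof (rule coord_mod_comb[OF B U W fin(1)])
    show "f c - (\<Sum>s\<in>B. coord_mod B W c s *\<^sub>R f s) \<in> W"
    proof -
      have "f (c - (\<Sum>s\<in>B. coord_mod B W c s *\<^sub>R s)) \<in> W"
        using coord_mod(2)[OF B, of c] c sub f(3) by auto
      then show ?thesis
        by (simp add: linear_diff[OF f(1)] linear_sum[OF f(1)] linear_cmul[OF f(1)])
    qed
  qed (use c sub f in auto)
  have ch: "coord_mod C W u c = (\<Sum>b\<in>B. coord_mod B W u b * coord_mod C W b c)" if "u \<in> U" for u c
    using that sub coord_mod(2)[OF B that]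
    by (intro coord_mod_comb[OF C U W fin(1)]) auto
  have ch': "coord_mod B W u b = (\<Sum>c\<in>C. coord_mod C W u c * coord_mod B W c b)" if "u \<in> U" for u b
    using that sub coord_mod(2)[OF C that]
    by (intro coord_mod_comb[OF B U W fin(2)]) auto
  have "(\<Sum>c\<in>C. coord_mod C W (f c) c)
      = (\<Sum>c\<in>C. \<Sum>b\<in>B. \<Sum>b'\<in>B. coord_mod B W c b' * coord_mod B W (f b') b * coord_mod C W b c)"
  proof (rule sum.cong)
    fix c assume c: "c \<in> C"
    then have "f c \<in> U" using sub f(2) by auto
    from ch[OF this] show "coord_mod C W (f c) c
        = (\<Sum>b\<in>B. \<Sum>b'\<in>B. coord_mod B W c b' * coord_mod B W (f b') b * coord_mod C W b c)"
      by (simp add: im[OF c] sum_distrib_right)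
  qed simp
  also have "\<dots> = (\<Sum>b\<in>B. \<Sum>b'\<in>B. \<Sum>c\<in>C. coord_mod B W c b' * coord_mod B W (f b') b * coord_mod C W b c)"
    by (subst sum.swap, rule sum.cong[OF refl], rule sum.swap)
  also have "\<dots> = (\<Sum>b\<in>B. \<Sum>b'\<in>B. coord_mod B W (f b') b * coord_mod B W b b')"
  proof (intro sum.cong refl)
    fix b b' assume b: "b \<in> B" "b' \<in> B"
    then have "b \<in> U" using sub by auto
    from ch'[OF this, of b']
    show "(\<Sum>c\<in>C. coord_mod B W c b' * coord_mod B W (f b') b * coord_mod C W b c)
        = coord_mod B W (f b') b * coord_mod B W b b'"
      by (simp add: sum_distrib_left mult_ac)
  qed
  also have "\<dots> = (\<Sum>b'\<in>B. \<Sum>b\<in>B. coord_mod B W (f b') b * coord_mod B W b b')"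
    by (rule sum.swap)
  also have "\<dots> = (\<Sum>b'\<in>B. coord_mod B W (f b') b')"
  proof (rule sum.cong)
    fix b' assume "b' \<in> B"
    then show "(\<Sum>b\<in>B. coord_mod B W (f b') b * coord_mod B W b b') = coord_mod B W (f b') b'"
      using sub f(2) coord_mod(2)[OF B, of "f b'"]
      by (intro coord_mod_comb[OF B U W fin(1), symmetric]) auto
  qed simp
  finally show ?thesis by (simp add: quotient_trace_def B_def Let_def)
qed

end

theory Submission
  imports Defs
begin

text \<open>
  A G2-structure \<open>\<phi>\<close> has a cross product: \<open>\<phi>(u, w, -) \<noteq> 0\<close> for linearly independent \<open>u\<close>, \<open>w\<close>.
  If \<open>\<phi> = d\<alpha>\<close>, then for commuting \<open>u, w \<in> \<nn>\<close> with \<open>\<alpha>([u, z], w) = \<alpha>([w, z], u)\<close> on \<open>\<nn>\<close>, the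
  1-form \<open>\<phi>(u, w, -)\<close> vanishes as soon as \<open>\<alpha>(Du, w) = \<alpha>(Dw, u)\<close>. For abelian \<open>\<nn>\<close> and any
  \<open>u\<close>, this is one linear condition on \<open>w\<close>; for \<open>\<nn>\<^sub>1\<close> one takes \<open>u = e\<^sub>6\<close> and solves it for \<open>w\<close> in the
  span of \<open>e\<^sub>3, e\<^sub>4\<close>. For \<open>\<nn>\<^sub>2\<close> take \<open>u = e\<^sub>5\<close>, \<open>w = e\<^sub>6\<close>, which span the centre: the
  condition says that the trace of \<open>D\<close> on the centre times \<open>\<alpha>(e\<^sub>5, e\<^sub>6)\<close> vanishes. As \<open>D\<close> acts
  there as multiplication by a complex number \<open>p + iq\<close>, this trace is \<open>2p\<close>, and strong
  unimodularity forces \<open>p = 0\<close>, also in the case where \<open>D\<close> is nilpotent.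
\<close>

section \<open>Alternating forms\<close>

lemma alternating_form_linear:
  assumes "alternating_form k \<omega>" "length vs = k" "i < k"
  shows "linear (\<lambda>x. \<omega> (vs[i := x]))"
  using assms by (simp add: alternating_form_def)

lemma alternating_form_repeat:
  assumes "alternating_form k \<omega>" "length vs = k" "i < k" "j < k" "i \<noteq> j" "vs ! i = vs ! j"
  shows "\<omega> vs = 0"
  using assms by (metis alternating_form_def linorder_neqE_nat)

text \<open>Cramer's rule: expand by linearity in slot \<open>i\<close>; each term with
  \<open>j \<noteq> i\<close> repeats an argument and drops out.\<close>

lemma alternating_form_update_sum:
  assumes \<omega>: "alternating_form k \<omega>" and len: "length vs = k" and i: "i < k"
  shows "\<omega> (vs[i := \<Sum>j<k. c j *\<^sub>R vs ! j]) = c i * \<omega> vs"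
proof -
  have lin: "linear (\<lambda>x. \<omega> (vs[i := x]))"
    using alternating_form_linear[OF \<omega> len i] .
  have "\<omega> (vs[i := \<Sum>j<k. c j *\<^sub>R vs ! j]) = (\<Sum>j<k. c j * \<omega> (vs[i := vs ! j]))"
    by (simp add: linear_sum[OF lin] linear_cmul[OF lin])
  also have "\<dots> = (\<Sum>j<k. if j = i then c i * \<omega> vs else 0)"
  proof (rule sum.cong)
    fix j assume "j \<in> {..<k}"
    then show "c j * \<omega> (vs[i := vs ! j]) = (if j = i then c i * \<omega> vs else 0)"
      using alternating_form_repeat[OF \<omega>, of "vs[i := vs ! j]" i j] len i by auto
  qed simp
  finally show ?thesis using i by simp
qed

text \<open>A relation with nonzero coefficient \<open>c v\<close> at \<open>v = vs ! i\<close>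
  would give \<open>0 = c v * \<omega> vs\<close> by \<open>alternating_form_update_sum\<close>. So
  the entries are independent, and since there are \<open>DIM('a)\<close> of them they span.\<close>

lemma top_form_nonzero_spans:
  fixes \<omega> :: "'a::euclidean_space list \<Rightarrow> real"
  assumes \<omega>: "alternating_form DIM('a) \<omega>" and nz: "\<omega> vs \<noteq> 0"
  obtains c where "u = (\<Sum>j<DIM('a). c j *\<^sub>R vs ! j)"
proof -
  have len: "length vs = DIM('a)"
    using \<omega> nz by (auto simp: alternating_form_def)
  have dist: "distinct vs"
    using alternating_form_repeat[OF \<omega> len] nz len by (metis distinct_conv_nth)
  have reindex: "(\<Sum>v\<in>set vs. c v *\<^sub>R v) = (\<Sum>j<DIM('a). c (vs ! j) *\<^sub>R vs ! j)" for c
    using sum.reindex_bij_betw[OF bij_betw_nth[OF dist refl refl], of "\<lambda>v. c v *\<^sub>R v"] len by simp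
  have "independent (set vs)"
  proof
    assume "dependent (set vs)"
    then obtain c v where c: "v \<in> set vs" "c v \<noteq> 0" "(\<Sum>v\<in>set vs. c v *\<^sub>R v) = 0"
      by (auto simp: dependent_finite)
    then obtain i where i: "i < DIM('a)" "v = vs ! i"
      using len by (metis in_set_conv_nth)
    have "\<omega> (vs[i := 0]) = c v * \<omega> vs"
      using alternating_form_update_sum[OF \<omega> len i(1), of "\<lambda>j. c (vs ! j)"] c(3) i(2)
      by (simp flip: reindex)
    moreover have "\<omega> (vs[i := 0]) = 0"
      using linear_0[OF alternating_form_linear[OF \<omega> len i(1)]] .
    ultimately show False using c(2) nz by simp
  qed
  moreover have "card (set vs) = DIM('a)"
    using dist len by (simp add: distinct_card)
  ultimately have "UNIV \<subseteq> span (set vs)"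
    by (intro card_ge_dim_independent) auto
  then have "u \<in> span (set vs)" by auto
  then obtain c where "u = (\<Sum>v\<in>set vs. c v *\<^sub>R v)"
    by (auto simp: span_finite)
  then show ?thesis using that[of "\<lambda>j. c (vs ! j)"] by (simp add: reindex)
qed

text \<open>Steinitz exchange, carried out twice: putting a vector in the place of an entry on which
  it has a nonzero coefficient multiplies the value of \<open>\<omega>\<close> by that
  coefficient.\<close>

lemma top_form_exchange:
  fixes \<omega> :: "'a::euclidean_space list \<Rightarrow> real"
  assumes \<omega>: "alternating_form DIM('a) \<omega>" and nz: "\<omega> vs \<noteq> 0"
    and indep: "\<And>s t. s *\<^sub>R u + t *\<^sub>R w = 0 \<Longrightarrow> s = 0 \<and> t = 0"
  obtains vs' where "\<omega> vs' \<noteq> 0" "u \<in> set vs'" "w \<in> set vs'"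
proof -
  let ?n = "DIM('a)"
  have len: "length vs = ?n"
    using \<omega> nz by (auto simp: alternating_form_def)
  obtain c where c: "u = (\<Sum>j<?n. c j *\<^sub>R vs ! j)"
    using top_form_nonzero_spans[OF \<omega> nz] .
  have "u \<noteq> 0" using indep[of 1 0] by auto
  then obtain i where i: "i < ?n" "c i \<noteq> 0"
    using c by (metis (mono_tags, lifting) lessThan_iff scaleR_zero_left sum.neutral)
  define us where "us = vs[i := u]"
  have us: "length us = ?n" "us ! i = u" using len i by (auto simp: us_def)
  have nz': "\<omega> us \<noteq> 0"
    using alternating_form_update_sum[OF \<omega> len i(1), of c] i(2) nz by (simp add: us_def flip: c)
  obtain d where d: "w = (\<Sum>j<?n. d j *\<^sub>R us ! j)"
    using top_form_nonzero_spans[OF \<omega> nz'] .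
  \<comment> \<open>The second exchange must not remove \<open>u\<close> from slot \<open>i\<close>.
    Another slot is available because \<open>w\<close> is not a multiple of
    \<open>u\<close>.\<close>
  have "\<exists>j<?n. j \<noteq> i \<and> d j \<noteq> 0"
  proof (rule ccontr)
    assume "\<not> (\<exists>j<?n. j \<noteq> i \<and> d j \<noteq> 0)"
    then have "w = (\<Sum>j<?n. if j = i then d i *\<^sub>R u else 0)"
      unfolding d by (intro sum.cong) (auto simp: us)
    then have "w = d i *\<^sub>R u" using i by simp
    then show False using indep[of "d i" "-1"] by simp
  qed
  then obtain j where j: "j < ?n" "j \<noteq> i" "d j \<noteq> 0" by blast
  have "\<omega> (us[j := w]) \<noteq> 0"
    using alternating_form_update_sum[OF \<omega> us(1) j(1), of d] j(3) nz' by (simp flip: d)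
  moreover have "u \<in> set (us[j := w])" "w \<in> set (us[j := w])"
    using us i j by (metis length_list_update nth_list_update_neq nth_mem,
        metis length_list_update nth_list_update_eq nth_mem)
  ultimately show ?thesis using that by blast
qed

lemma alternating_form_contraction:
  assumes "alternating_form (Suc k) \<omega>"
  shows "alternating_form k (contraction v \<omega>)"
  unfolding alternating_form_def contraction_def
proof (intro conjI allI impI)
  fix vs :: "'a list"
  show "\<omega> (v # vs) = 0" if "length vs \<noteq> k"
    using assms that by (simp add: alternating_form_def)
  show "linear (\<lambda>x. \<omega> (v # vs[i := x]))" if "length vs = k" "i < k" for i
    using alternating_form_linear[OF assms, of "v # vs" "Suc i"] that by simp
  show "\<omega> (v # vs) = 0" if "length vs = k" "i < j" "j < k" "vs ! i = vs ! j" for i j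
    using alternating_form_repeat[OF assms, of "v # vs" "Suc i" "Suc j"] that by simp
qed

text \<open>Polarisation: expand the vanishing value at a repeated sum.\<close>

lemma alternating_form_3_swaps:
  assumes "alternating_form 3 \<omega>"
  shows "\<omega> [y, x, z] = - \<omega> [x, y, z]" "\<omega> [x, z, y] = - \<omega> [x, y, z]"
proof -
  have l0: "linear (\<lambda>x. \<omega> [x, y, z])" and l1: "linear (\<lambda>y. \<omega> [x, y, z])"
    and l2: "linear (\<lambda>z. \<omega> [x, y, z])" for x y z
    using alternating_form_linear[OF assms, of "[x, y, z]" 0]
      alternating_form_linear[OF assms, of "[x, y, z]" 1]
      alternating_form_linear[OF assms, of "[x, y, z]" 2] by (simp_all add: numeral_2_eq_2)
  have r0: "\<omega> [x, x, z] = 0" and r1: "\<omega> [z, x, x] = 0" for x z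
    using alternating_form_repeat[OF assms, of "[x, x, z]" 0 1]
      alternating_form_repeat[OF assms, of "[z, x, x]" 1 2] by simp_all
  show "\<omega> [y, x, z] = - \<omega> [x, y, z]"
    using r0[of "x + y" z] r0[of x z] r0[of y z] by (simp add: linear_add[OF l0] linear_add[OF l1])
  show "\<omega> [x, z, y] = - \<omega> [x, y, z]"
    using r1[of x "y + z"] r1[of x y] r1[of x z] by (simp add: linear_add[OF l1] linear_add[OF l2])
qed

section \<open>Wedge products\<close>

text \<open>Both properties are checked on the sum over permutations: linearity holds summand by
  summand, whereas alternation comes from summands cancelling.\<close>

lemma alternating_form_wedge:
  assumes \<omega>: "alternating_form k \<omega>" and \<eta>: "alternating_form l \<eta>"
  shows "alternating_form (k + l) (wedge k l \<omega> \<eta>)"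
  unfolding alternating_form_def
proof (intro conjI allI impI)
  fix vs :: "'a list"
  show "wedge k l \<omega> \<eta> vs = 0" if "length vs \<noteq> k + l"
    using that by (simp add: wedge_def)
  show "linear (\<lambda>x. wedge k l \<omega> \<eta> (vs[m := x]))" if len: "length vs = k + l" and m: "m < k + l" for m
  proof -
    let ?A = "\<lambda>p ws. \<omega> (map (\<lambda>i. ws ! p i) [0..<k])"
    let ?B = "\<lambda>p ws. \<eta> (map (\<lambda>i. ws ! p i) [k..<k + l])"
    have "linear (\<lambda>x. of_int (sign p) * ?A p (vs[m := x]) * ?B p (vs[m := x]))"
      if p: "p permutes {..<k + l}" for p
    proof -
      \<comment> \<open>\<open>q\<close> is the only position at which slot \<open>m\<close> is
        read, so \<open>x\<close> enters exactly one factor: \<open>\<omega>\<close> if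
        \<open>q < k\<close>, otherwise \<open>\<eta>\<close> at its own position
        \<open>q - k\<close>.\<close>
      obtain q where q: "q < k + l" "p q = m"
        using permutes_image[OF p] m by (metis imageE lessThan_iff)
      have pq: "p i = m \<longleftrightarrow> i = q" for i
        using permutes_inj[OF p] q by (auto dest: injD)
      have pl: "p i < k + l" if "i < k + l" for i
        using permutes_in_image[OF p, of i] that by simp
      have upd: "vs[m := x] ! p i = (if i = q then x else vs ! p i)" if "i < k + l" for x i
        using pl[OF that] len pq[of i] m by (cases "i = q") auto
      show ?thesis
      proof (cases "q < k")
        case True
        then have e: "map (\<lambda>i. vs[m := x] ! p i) [0..<k] = (map (\<lambda>i. vs ! p i) [0..<k])[q := x]"
          and e': "map (\<lambda>i. vs[m := x] ! p i) [k..<k + l] = map (\<lambda>i. vs ! p i) [k..<k + l]" for x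
          by (auto intro!: nth_equalityI simp: nth_list_update upd)
        have lin: "linear (\<lambda>x. \<omega> ((map (\<lambda>i. vs ! p i) [0..<k])[q := x]))"
          using True by (intro alternating_form_linear[OF \<omega>]) auto
        show ?thesis
          unfolding e e' by (rule linearI) (simp_all add: linear_add[OF lin] linear_cmul[OF lin] algebra_simps)
      next
        case False
        then have e: "map (\<lambda>i. vs[m := x] ! p i) [k..<k + l] = (map (\<lambda>i. vs ! p i) [k..<k + l])[q - k := x]"
          and e': "map (\<lambda>i. vs[m := x] ! p i) [0..<k] = map (\<lambda>i. vs ! p i) [0..<k]" for x
          by (auto intro!: nth_equalityI simp: nth_list_update upd)
        have lin: "linear (\<lambda>x. \<eta> ((map (\<lambda>i. vs ! p i) [k..<k + l])[q - k := x]))"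
          using False q by (intro alternating_form_linear[OF \<eta>]) auto
        show ?thesis
          unfolding e e' by (rule linearI) (simp_all add: linear_add[OF lin] linear_cmul[OF lin] algebra_simps)
      qed
    qed
    then have lin: "linear (\<lambda>x. \<Sum>p | p permutes {..<k + l}.
        of_int (sign p) * ?A p (vs[m := x]) * ?B p (vs[m := x]))"
      by (intro linear_compose_sum) auto
    show ?thesis
      by (rule linearI)
        (simp_all add: wedge_def len linear_add[OF lin] linear_cmul[OF lin] add_divide_distrib)
  qed
  show "wedge k l \<omega> \<eta> vs = 0"
    if len: "length vs = k + l" and ij: "i < j" "j < k + l" and eq: "vs ! i = vs ! j" for i j
  proof -
    let ?t = "Transposition.transpose i j"
    let ?F = "\<lambda>p. \<omega> (map (\<lambda>i. vs ! p i) [0..<k]) * \<eta> (map (\<lambda>i. vs ! p i) [k..<k + l])"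
    let ?S = "\<Sum>p | p permutes {..<k + l}. of_int (sign p) * ?F p"
    have t: "?t permutes {..<k + l}"
      using ij by (intro permutes_swap_id) auto
    have vt: "vs ! ?t m = vs ! m" for m
      using eq by (auto simp: Transposition.transpose_def)
    \<comment> \<open>Composing with the transposition permutes the summands. It reverses every
      sign, and it leaves the arguments alone as \<open>vs ! i = vs ! j\<close>; hence the sum is
      its own negative.\<close>
    have "?S = (\<Sum>p | p permutes {..<k + l}. of_int (sign (?t \<circ> p)) * ?F (?t \<circ> p))"
      by (rule setum_permutations_compose_left[OF t])
    also have "\<dots> = (\<Sum>p | p permutes {..<k + l}. - (of_int (sign p) * ?F p))"
    proof (rule sum.cong)
      fix p assume "p \<in> {p. p permutes {..<k + l}}"
      then have "permutation p" by (auto simp: permutation_permutes)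
      then have "sign (?t \<circ> p) = - sign p"
        using ij by (simp add: sign_compose permutation_swap_id sign_swap_id)
      then show "of_int (sign (?t \<circ> p)) * ?F (?t \<circ> p) = - (of_int (sign p) * ?F p)"
        by (simp add: vt)
    qed simp
    finally have "?S = 0" by (simp add: sum_negf)
    then show ?thesis by (simp add: wedge_def mult.assoc)
  qed
qed

lemma wedge_eq_0I:
  assumes "\<And>p. p permutes {..<k + l} \<Longrightarrow>
      \<omega> (map (\<lambda>i. vs ! p i) [0..<k]) = 0 \<or> \<eta> (map (\<lambda>i. vs ! p i) [k..<k + l]) = 0"
  shows "wedge k l \<omega> \<eta> vs = 0"
proof -
  have "(\<Sum>p | p permutes {..<k + l}. of_int (sign p) * \<omega> (map (\<lambda>i. vs ! p i) [0..<k])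
      * \<eta> (map (\<lambda>i. vs ! p i) [k..<k + l])) = 0"
    by (rule sum.neutral) (use assms in auto)
  then show ?thesis by (simp add: wedge_def)
qed

lemma set_permuted_split:
  assumes p: "p permutes {..<k + l}" and "length vs = k + l"
  shows "set vs = set (map (\<lambda>i. vs ! p i) [0..<k]) \<union> set (map (\<lambda>i. vs ! p i) [k..<k + l])"
proof -
  have "set vs = (!) vs ` (p ` {..<k + l})"
    unfolding permutes_image[OF p] using assms(2) by (auto simp: set_conv_nth)
  also have "{..<k + l} = {0..<k} \<union> {k..<k + l}" by auto
  finally show ?thesis by (simp add: image_Un image_image)
qed

text \<open>In each summand \<open>v\<close> is handed to one of the two factors.\<close>

lemma wedge_annihilated:
  assumes "\<And>ws. v \<in> set ws \<Longrightarrow> \<omega> ws = 0" "\<And>ws. v \<in> set ws \<Longrightarrow> \<eta> ws = 0" "v \<in> set vs"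
  shows "wedge k l \<omega> \<eta> vs = 0"
proof (cases "length vs = k + l")
  case True
  show ?thesis
    by (rule wedge_eq_0I) (use set_permuted_split[OF _ True] assms in blast)
qed (simp add: wedge_def)

section \<open>The cross product of a G2-structure\<close>

text \<open>
  With \<open>\<phi>(u, w, -) = 0\<close>, both \<open>u\<close> and \<open>w\<close> annihilate \<open>\<iota>\<^sub>u\<phi>\<close>, so each summand of
  \<open>\<iota>\<^sub>u\<phi> \<and> \<iota>\<^sub>u\<phi> \<and> \<phi>\<close> evaluated on a list containing \<open>u\<close> and \<open>w\<close> either feeds one of them to
  \<open>\<iota>\<^sub>u\<phi>\<close> or feeds both of them to \<open>\<phi>\<close>.
\<close>

lemma G2_structure_cross_nonzero:
  fixes \<phi> :: "'a::euclidean_space list \<Rightarrow> real"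
  assumes G2: "G2_structure \<phi>"
    and indep: "\<And>s t. s *\<^sub>R u + t *\<^sub>R w = 0 \<Longrightarrow> s = 0 \<and> t = 0"
  shows "\<exists>z. \<phi> [u, w, z] \<noteq> 0"
proof (rule ccontr)
  assume "\<not> (\<exists>z. \<phi> [u, w, z] \<noteq> 0)"
  then have uw: "\<phi> [u, w, z] = 0" for z by simp
  have dim: "DIM('a) = 7" and \<phi>: "alternating_form 3 \<phi>"
    using G2 by (auto simp: G2_structure_def)
  note sw = alternating_form_3_swaps[OF \<phi>]
  have rep: "\<phi> [x, x, z] = 0" for x z using sw(1)[of x x z] by simp
  have "u \<noteq> 0" "u \<noteq> w" using indep[of 1 0] indep[of 1 "-1"] by auto
  define \<tau> where "\<tau> = contraction u \<phi>"
  define \<sigma> where "\<sigma> = wedge 2 2 \<tau> \<tau>"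
  have \<tau>: "alternating_form 2 \<tau>"
    unfolding \<tau>_def using \<phi> by (intro alternating_form_contraction) (simp add: numeral_3_eq_3)
  have \<sigma>: "alternating_form 4 \<sigma>"
    using alternating_form_wedge[OF \<tau> \<tau>] by (simp add: \<sigma>_def)
  have ann\<tau>: "\<tau> ws = 0" if v: "v \<in> set ws" "v = u \<or> v = w" for v ws
  proof (cases "length ws = 2")
    case True
    then obtain x y where "ws = [x, y]"
      by (metis One_nat_def Suc_1 length_0_conv length_Suc_conv)
    then show ?thesis
      using v uw[of x] uw[of y] rep[of u x] rep[of u y] sw(2)[of u x y]
      by (auto simp: \<tau>_def contraction_def)
  qed (use \<tau> in \<open>simp add: alternating_form_def\<close>)
  have ann\<sigma>: "\<sigma> ws = 0" if "v \<in> set ws" "v = u \<or> v = w" for v ws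
    unfolding \<sigma>_def using that by (intro wedge_annihilated[of v]) (auto intro: ann\<tau>)
  have perms: "\<phi> [u, w, z] = 0" "\<phi> [w, u, z] = 0" "\<phi> [u, z, w] = 0"
    "\<phi> [w, z, u] = 0" "\<phi> [z, u, w] = 0" "\<phi> [z, w, u] = 0" for z
    using uw[of z] sw(1)[of w u z] sw(2)[of u z w] sw(2)[of w z u] sw(1)[of z u w] sw(1)[of z w u]
    by simp_all
  have ann\<phi>: "\<phi> ws = 0" if "u \<in> set ws" "w \<in> set ws" for ws
  proof (cases "length ws = 3")
    case True
    then obtain x y z where "ws = [x, y, z]"
      by (auto simp: numeral_3_eq_3 length_Suc_conv)
    then show ?thesis
      using that \<open>u \<noteq> w\<close> perms by auto
  qed (use \<phi> in \<open>simp add: alternating_form_def\<close>)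
  have "wedge 4 3 \<sigma> \<phi> vs = 0" for vs
  proof (rule ccontr)
    assume nz: "wedge 4 3 \<sigma> \<phi> vs \<noteq> 0"
    have top: "alternating_form DIM('a) (wedge 4 3 \<sigma> \<phi>)"
      using alternating_form_wedge[OF \<sigma> \<phi>] dim by simp
    \<comment> \<open>In top degree it suffices to test lists through both \<open>u\<close> and
      \<open>w\<close>: a nonzero value anywhere can be moved to such a list.\<close>
    obtain vs' where vs': "wedge 4 3 \<sigma> \<phi> vs' \<noteq> 0" "u \<in> set vs'" "w \<in> set vs'"
      using top_form_exchange[OF top nz indep] by blast
    then have len: "length vs' = 4 + 3"
      unfolding wedge_def by presburger
    have "wedge 4 3 \<sigma> \<phi> vs' = 0"
      by (rule wedge_eq_0I) (use set_permuted_split[OF _ len] vs' ann\<sigma> ann\<phi> in blast)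
    with vs' show False by simp
  qed
  then have "wedge 4 3 (wedge 2 2 (contraction u \<phi>) (contraction u \<phi>)) \<phi> = (\<lambda>_. 0)"
    by (auto simp: \<sigma>_def \<tau>_def)
  then show False using G2 \<open>u \<noteq> 0\<close> by (auto simp: G2_structure_def)
qed

section \<open>Structure equations\<close>

lemma alternating_form_1_linear:
  assumes "alternating_form 1 \<alpha>"
  shows "linear (\<lambda>x. \<alpha> [x])"
  using alternating_form_linear[OF assms, of "[0]" 0] by simp

lemma dual_bases_expand:
  assumes "dual_bases n b e"
  shows "x = (\<Sum>i\<in>{1..n}. e i [x] *\<^sub>R b i)"
proof -
  have lin: "linear (\<lambda>x. e i [x])" if "i \<in> {1..n}" for i
    using assms that by (intro alternating_form_1_linear) (auto simp: dual_bases_def)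
  have "id x = (\<Sum>i\<in>{1..n}. e i [x] *\<^sub>R b i)"
  proof (rule linear_eq_on[of id _ _ "b ` {1..n}"])
    show "linear (\<lambda>x. \<Sum>i\<in>{1..n}. e i [x] *\<^sub>R b i)"
    proof (intro linear_compose_sum ballI)
      show "linear (\<lambda>x. e i [x] *\<^sub>R b i)" if "i \<in> {1..n}" for i
        by (rule linearI) (simp_all add: linear_add[OF lin[OF that]] linear_cmul[OF lin[OF that]] scaleR_add_left)
    qed
    show "x \<in> span (b ` {1..n})" using assms by (auto simp: dual_bases_def)
    fix v assume "v \<in> b ` {1..n}"
    then obtain j where j: "j \<in> {1..n}" "v = b j" by auto
    have "(\<Sum>i\<in>{1..n}. e i [v] *\<^sub>R b i) = (\<Sum>i\<in>{1..n}. if i = j then b j else 0)"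
      using assms j by (intro sum.cong) (auto simp: dual_bases_def)
    then show "id v = (\<Sum>i\<in>{1..n}. e i [v] *\<^sub>R b i)" using j by simp
  qed (simp add: linear_id)
  then show ?thesis by simp
qed

lemma sum_1_to_6: "(\<Sum>i\<in>{1..6::nat}. f i) = f 1 + f 2 + f 3 + f 4 + f 5 + f 6"
proof -
  have "{1..6::nat} = {1, 2, 3, 4, 5, 6}" by auto
  then show ?thesis by (simp add: add.assoc)
qed

text \<open>As \<open>d\<alpha>(x, y) = -\<alpha>([x, y])\<close>, the structure equations are, up
  to sign, the coordinates of the bracket in the basis \<open>b\<close>.\<close>

lemma dual_bases_bracket:
  assumes "dual_bases 6 b e" "\<forall>i\<in>{1..4}. ce_d br (e i) = (\<lambda>_. 0)"
  shows "br x y = - (ce_d br (e 5) [x, y] *\<^sub>R b 5) - ce_d br (e 6) [x, y] *\<^sub>R b 6"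
proof -
  have "ce_d br (e i) [x, y] = 0" if "i \<in> {1..4}" for i using assms(2) that by simp
  from this[of 1] this[of 2] this[of 3] this[of 4] show ?thesis
    using dual_bases_expand[OF assms(1), of "br x y"] unfolding sum_1_to_6 by (simp add: ce_d_1)
qed

section \<open>Exact 3-forms on a semidirect product and the obstruction\<close>

lemma alternating_form_2:
  assumes "alternating_form 2 \<alpha>"
  shows "linear (\<lambda>x. \<alpha> [x, y])" "linear (\<lambda>y. \<alpha> [x, y])" "\<alpha> [x, x] = 0"
  using alternating_form_linear[OF assms, of "[x, y]" 0] alternating_form_linear[OF assms, of "[x, y]" 1]
    alternating_form_repeat[OF assms, of "[x, x]" 0 1] by simp_all

lemma homogeneous_pair: "\<exists>a b::real. (a \<noteq> 0 \<or> b \<noteq> 0) \<and> a * s + b * t = 0"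
  by (cases "s = 0") (rule exI[of _ 1], simp, rule exI[of _ t], rule exI[of _ "- s"], simp)

text \<open>The term of \<open>[x, y]\<close> drops out, and
  \<open>[(x, 0), (z, t)] = (br x z - t *\<^sub>R D x, 0)\<close>. Linearity then separates the
  contribution of the ideal from that of \<open>D\<close>.\<close>

lemma ce_d_semidirect:
  assumes \<alpha>: "alternating_form 2 \<alpha>" and D: "linear D" and br: "br x y = 0"
  shows "ce_d (semidirect br D) \<alpha> [(x, 0), (y, 0), (z, t)]
    = \<alpha> [(br x z, 0), (y, 0)] - \<alpha> [(br y z, 0), (x, 0)]
      - t * (\<alpha> [(D x, 0), (y, 0)] - \<alpha> [(D y, 0), (x, 0)])"
proof -
  note l = alternating_form_2(1)[OF \<alpha>]
  have "\<alpha> [(v - t *\<^sub>R v', 0), y] = \<alpha> [(v, 0), y] - t * \<alpha> [(v', 0), y]" for v v' y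
    using linear_diff[OF l, of "(v, 0)" "t *\<^sub>R (v', 0)"] linear_cmul[OF l, of t "(v', 0)"] by simp
  moreover have "\<alpha> [(0, 0), y] = 0" for y using linear_0[OF l] by (simp add: zero_prod_def)
  ultimately show ?thesis
    by (simp add: ce_d_2 semidirect_def br linear_0[OF D] algebra_simps)
qed

text \<open>The last two hypotheses kill the two parts of \<open>ce_d_semidirect\<close> for every
  third argument \<open>(z, t)\<close>, which contradicts
  \<open>G2_structure_cross_nonzero\<close>.\<close>

lemma not_G2_structureI:
  fixes br :: "'n::euclidean_space \<Rightarrow> 'n \<Rightarrow> 'n"
  assumes "alternating_form 2 \<alpha>" "linear D"
    and indep: "\<And>s t. s *\<^sub>R x + t *\<^sub>R y = 0 \<Longrightarrow> s = 0 \<and> t = 0"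
    and "br x y = 0"
    and "\<And>z. \<alpha> [(br x z, 0), (y, 0)] = \<alpha> [(br y z, 0), (x, 0)]"
    and "\<alpha> [(D x, 0), (y, 0)] = \<alpha> [(D y, 0), (x, 0)]"
  shows "\<not> G2_structure (ce_d (semidirect br D) \<alpha>)"
proof
  assume "G2_structure (ce_d (semidirect br D) \<alpha>)"
  then have "\<exists>z. ce_d (semidirect br D) \<alpha> [(x, 0), (y, 0), z] \<noteq> 0"
    using indep by (intro G2_structure_cross_nonzero) (auto simp: zero_prod_def)
  then show False
    using ce_d_semidirect[where br = br, OF assms(1,2,4)] assms(5,6) by auto
qed

text \<open>The defect \<open>f v\<close> of the symmetry condition is a linear functional of
  \<open>v\<close>, so its values at two vectors satisfy a nontrivial linear relation.\<close>

lemma exists_symmetric_combination: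
  assumes \<alpha>: "alternating_form 2 \<alpha>" and D: "linear D"
  obtains a b where "a \<noteq> 0 \<or> b \<noteq> 0"
    "\<alpha> [(D x, 0), (a *\<^sub>R y + b *\<^sub>R z, 0)] = \<alpha> [(D (a *\<^sub>R y + b *\<^sub>R z), 0), (x, 0::real)]"
proof -
  define f where "f v = \<alpha> [(D x, 0), (v, 0)] - \<alpha> [(D v, 0), (x, 0::real)]" for v
  note l = alternating_form_2(1)[OF \<alpha>] alternating_form_2(2)[OF \<alpha>]
  have lin0: "linear (\<lambda>v::'a. (v, 0::real))" by (rule linearI) auto
  have "linear f"
    unfolding f_def
    using linear_compose[OF linear_compose[OF D lin0] l(1)] linear_compose[OF lin0 l(2)]
    by (intro linear_compose_sub) (simp_all add: o_def)
  moreover obtain a b where "a \<noteq> 0 \<or> b \<noteq> 0" "a * f y + b * f z = 0"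
    using homogeneous_pair by blast
  ultimately show ?thesis
    using that[of a b] f_def[of "a *\<^sub>R y + b *\<^sub>R z"] by (simp add: linear_add linear_cmul)
qed

section \<open>The three families\<close>

lemma no_exact_G2_abelian:
  fixes br :: "'n::euclidean_space \<Rightarrow> 'n \<Rightarrow> 'n"
  assumes dim: "DIM('n) \<ge> 3" and D: "linear D" and "abelian br" and \<alpha>: "alternating_form 2 \<alpha>"
  shows "\<not> G2_structure (ce_d (semidirect br D) \<alpha>)"
proof -
  have br: "br x y = 0" for x y using assms(3) by (simp add: abelian_def)
  \<comment> \<open>Three orthonormal vectors: \<open>x\<close> serves as \<open>u\<close>, and
    \<open>w\<close> is sought in the plane of \<open>y\<close> and \<open>z\<close>, which keeps it
    independent of \<open>x\<close>.\<close>
  obtain S :: "'n set" where S: "S \<subseteq> Basis" "card S = 3"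
    using obtain_subset_with_card_n[OF dim] by metis
  then obtain x y z where xyz: "S = {x, y, z}" "x \<noteq> y" "x \<noteq> z" "y \<noteq> z"
    by (auto simp: card_3_iff)
  obtain a b where ab: "a \<noteq> 0 \<or> b \<noteq> 0"
    "\<alpha> [(D x, 0), (a *\<^sub>R y + b *\<^sub>R z, 0)] = \<alpha> [(D (a *\<^sub>R y + b *\<^sub>R z), 0), (x, 0)]"
    using exists_symmetric_combination[OF \<alpha> D] .
  have dots: "x \<bullet> x = 1" "y \<bullet> y = 1" "z \<bullet> z = 1" "x \<bullet> y = 0" "x \<bullet> z = 0" "y \<bullet> z = 0"
    "y \<bullet> x = 0" "z \<bullet> x = 0" "z \<bullet> y = 0"
    using S xyz by (auto simp: inner_Basis)
  show ?thesis
  proof (rule not_G2_structureI[OF \<alpha> D _ _ _ ab(2)])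
    fix s t assume eq: "s *\<^sub>R x + t *\<^sub>R (a *\<^sub>R y + b *\<^sub>R z) = 0"
    show "s = 0 \<and> t = 0"
      using arg_cong[OF eq, of "\<lambda>v. v \<bullet> x"] arg_cong[OF eq, of "\<lambda>v. v \<bullet> y"]
        arg_cong[OF eq, of "\<lambda>v. v \<bullet> z"] ab(1) dots
      by (auto simp: inner_add_left)
  qed (simp_all add: br linear_0[OF alternating_form_2(1)[OF \<alpha>]] flip: zero_prod_def)
qed

text \<open>\<open>b 6\<close> is central. The forms \<open>e 3\<close> and \<open>e 4\<close> occur
  only in the differential of \<open>e 6\<close>, so brackets with a vector \<open>w\<close> in the
  plane of \<open>b 3\<close> and \<open>b 4\<close> are multiples of \<open>b 6\<close>, and
  \<alpha> vanishes on them paired with \<open>b 6\<close>. Only the condition on \<open>D\<close>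
  is left, and a plane has room to solve it.\<close>

lemma no_exact_G2_n1:
  fixes br :: "'n::euclidean_space \<Rightarrow> 'n \<Rightarrow> 'n"
  assumes D: "linear D" and "is_n1 br" and \<alpha>: "alternating_form 2 \<alpha>"
  shows "\<not> G2_structure (ce_d (semidirect br D) \<alpha>)"
proof -
  obtain b e where dual: "dual_bases 6 b e" and de: "\<forall>i\<in>{1..4}. ce_d br (e i) = (\<lambda>_. 0)"
    and de5: "ce_d br (e 5) = wedge 1 1 (e 1) (e 2)" and de6: "ce_d br (e 6) = wedge 1 1 (e 3) (e 4)"
    using assms(2) by (auto simp: is_n1_def)
  have br: "br x y = - ((e 1 [x] * e 2 [y] - e 1 [y] * e 2 [x]) *\<^sub>R b 5)
      - (e 3 [x] * e 4 [y] - e 3 [y] * e 4 [x]) *\<^sub>R b 6" for x y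
    using dual_bases_bracket[OF dual de, of x y] unfolding de5 de6 wedge_1_1 .
  have eb: "e i [b j] = (if i = j then 1 else 0)" if "i \<in> {1..6}" "j \<in> {1..6}" for i j
    using dual that by (auto simp: dual_bases_def)
  have e: "linear (\<lambda>x. e i [x])" if "i \<in> {1..6}" for i
    using dual that by (intro alternating_form_1_linear) (auto simp: dual_bases_def)
  note e_simps = linear_add[OF e] linear_cmul[OF e] linear_0[OF e] eb
  obtain p q where pq: "p \<noteq> 0 \<or> q \<noteq> 0"
    "\<alpha> [(D (b 6), 0), (p *\<^sub>R b 3 + q *\<^sub>R b 4, 0)] = \<alpha> [(D (p *\<^sub>R b 3 + q *\<^sub>R b 4), 0), (b 6, 0)]"
    using exists_symmetric_combination[OF \<alpha> D] .
  note \<alpha>s = alternating_form_2[OF \<alpha>]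
  show ?thesis
  proof (rule not_G2_structureI[OF \<alpha> D _ _ _ pq(2)])
    fix s t assume eq: "s *\<^sub>R b 6 + t *\<^sub>R (p *\<^sub>R b 3 + q *\<^sub>R b 4) = 0"
    show "s = 0 \<and> t = 0"
      using arg_cong[OF eq, of "\<lambda>v. e 6 [v]"] arg_cong[OF eq, of "\<lambda>v. e 3 [v]"]
        arg_cong[OF eq, of "\<lambda>v. e 4 [v]"] pq(1) by (auto simp: e_simps)
  next
    show "br (b 6) (p *\<^sub>R b 3 + q *\<^sub>R b 4) = 0" by (simp add: br e_simps)
    fix z
    define c where "c = - (p * e 4 [z] - q * e 3 [z])"
    have c: "br (p *\<^sub>R b 3 + q *\<^sub>R b 4) z = c *\<^sub>R b 6"
      by (simp add: br e_simps c_def mult.commute flip: scaleR_minus_left)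
    have "\<alpha> [(c *\<^sub>R b 6, 0), (b 6, 0)] = 0"
      using linear_cmul[OF \<alpha>s(1), of c "(b 6, 0)" "(b 6, 0)"] \<alpha>s(3) by simp
    moreover have "br (b 6) z = 0" by (simp add: br e_simps)
    ultimately show "\<alpha> [(br (b 6) z, 0), (p *\<^sub>R b 3 + q *\<^sub>R b 4, 0)]
        = \<alpha> [(br (p *\<^sub>R b 3 + q *\<^sub>R b 4) z, 0), (b 6, 0)]"
      using linear_0[OF \<alpha>s(1)] by (simp add: c zero_prod_def)
  qed
qed

section \<open>Strong unimodularity and the trace on the centre\<close>

text \<open>The ideal \<open>UNIV \<times> {0}\<close> is nilpotent of codimension one, so it lies
  in the nilradical \<open>m\<close>. Either it equals \<open>m\<close>, and the trace condition for
  \<open>(0, 1)\<close> speaks of its lower central series, or \<open>m\<close> contains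
  \<open>(0, 1)\<close>, and nilpotency of \<open>m\<close> makes \<open>D\<close>
  nilpotent.\<close>

lemma strongly_unimodular_cases:
  fixes br :: "'n::euclidean_space \<Rightarrow> 'n \<Rightarrow> 'n"
  assumes su: "strongly_unimodular (semidirect br D)"
    and br: "bilinear br" and D: "linear D" and nil: "\<exists>k. lower_central br UNIV k = {0}"
  obtains "\<And>i. quotient_trace (semidirect br D (0, 1)) (lower_central br UNIV i \<times> {0})
      (lower_central br UNIV (Suc i) \<times> {0}) = 0"
    | k where "\<And>x. (D ^^ k) x = 0"
proof -
  let ?L = "lower_central (semidirect br D)"
  obtain m where m: "is_nilradical (semidirect br D) m"
    and tr: "\<And>x i. quotient_trace (semidirect br D x) (?L m i) (?L m (Suc i)) = 0"
    using su by (auto simp: strongly_unimodular_def)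
  have D0: "D 0 = 0" using linear_0[OF D] .
  have span0: "span (A \<times> {0::real}) = span A \<times> {0}" for A :: "'n set"
  proof -
    have "linear (\<lambda>v::'n. (v, 0::real))" by (rule linearI) auto
    moreover have "A \<times> {0::real} = (\<lambda>v. (v, 0)) ` A" for A :: "'n set" by auto
    ultimately show ?thesis by (simp add: linear_span_image)
  qed
  \<comment> \<open>Inside the ideal the last coordinate is 0, so \<open>D\<close> does not enter
    the brackets.\<close>
  have low: "?L (UNIV \<times> {0}) i = lower_central br UNIV i \<times> {0}" for i
  proof (induction i)
    case (Suc i)
    have "{semidirect br D x y |x y. x \<in> UNIV \<times> {0} \<and> y \<in> lower_central br UNIV i \<times> {0}}
        = {br x y |x y. x \<in> UNIV \<and> y \<in> lower_central br UNIV i} \<times> {0}"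
      by (auto simp: semidirect_def D0)
    then show ?case by (simp add: Suc bracket_span_def span0)
  qed simp
  have "lie_ideal (semidirect br D) (UNIV \<times> {0})"
    by (auto simp: lie_ideal_def semidirect_def intro!: subspace_Times)
  moreover have "\<exists>k. ?L (UNIV \<times> {0}) k = {0}"
    using nil by (auto simp: low zero_prod_def)
  ultimately have sub: "UNIV \<times> {0} \<subseteq> m"
    using m by (auto simp: is_nilradical_def nilpotent_ideal_def)
  show ?thesis
  proof (cases "m = UNIV \<times> {0}")
    case True
    then show ?thesis using that(1) tr[of "(0, 1)"] by (simp only: low)
  next
    case False
    then obtain v s where vs: "(v, s) \<in> m" "s \<noteq> 0" using sub by auto
    have "subspace m" and nilm: "\<exists>k. ?L m k = {0}"
      using m by (auto simp: is_nilradical_def nilpotent_ideal_def lie_ideal_def)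
    then have "(1 / s) *\<^sub>R ((v, s) - (v, 0)) \<in> m"
      using vs sub by (intro subspace_scale subspace_diff) auto
    then have e7: "(0, 1) \<in> m" using vs by simp
    \<comment> \<open>Applying \<open>D\<close> is bracketing with \<open>(0, 1)\<close>, an element
      of \<open>m\<close>, and so descends one step in the lower central series of
      \<open>m\<close>.\<close>
    have "((D ^^ k) x, 0) \<in> ?L m k" for k x
    proof (induction k)
      case 0
      then show ?case using sub by auto
    next
      case (Suc k)
      have "((D ^^ Suc k) x, 0) = semidirect br D (0, 1) ((D ^^ k) x, 0)"
        by (simp add: semidirect_def bilinear_lzero[OF br])
      then show ?case
        using Suc e7 unfolding lower_central.simps bracket_span_def by (intro span_base) blast
    qed
    moreover obtain k where "?L m k = {0}" using nilm by blast
    ultimately have "(D ^^ k) x = 0" for x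
      by (metis prod.inject singletonD zero_prod_def)
    then show ?thesis using that(2) by blast
  qed
qed

text \<open>Modulo \<open>{0}\<close> the coordinates are those of \<open>representation\<close>,
  and by \<open>quotient_trace_eq\<close> the given basis \<open>C\<close> may replace the one
  chosen in the definition.\<close>

lemma quotient_trace_span:
  assumes C: "independent C" and f: "linear f" "f ` span C \<subseteq> span C"
  shows "quotient_trace f (span C) {0} = (\<Sum>c\<in>C. representation C (f c) c)"
proof -
  have fin: "finite C" using C by (rule independent_imp_finite)
  have eq: "(\<Sum>c\<in>C. representation C u c *\<^sub>R c) = u" if "u \<in> span C" for u
    using sum_representation_eq[OF C that fin] by simp
  \<comment> \<open>The value 0 off \<open>C\<close>, required by \<open>basis_mod\<close>, is also
    the default of \<open>representation\<close>, so the two agree as functions.\<close>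
  have "a = representation C u" if "\<forall>c. c \<notin> C \<longrightarrow> a c = 0" "u - (\<Sum>c\<in>C. a c *\<^sub>R c) \<in> {0}" for a u
  proof -
    have sub: "{c. a c \<noteq> 0} \<subseteq> C" using that(1) by auto
    have "(\<Sum>c | a c \<noteq> 0. a c *\<^sub>R c) = (\<Sum>c\<in>C. a c *\<^sub>R c)"
      using sub fin by (intro sum.mono_neutral_left) auto
    also have "\<dots> = u" using that(2) by simp
    finally have u: "(\<Sum>c | a c \<noteq> 0. a c *\<^sub>R c) = u" .
    have "u \<in> span C"
      using that(2) span_sum[of C "\<lambda>c. a c *\<^sub>R c" C] by (auto intro: span_mul span_base)
    then show ?thesis
      using representation_eqI[OF C _ _ _ u] sub fin by (auto intro: finite_subset)
  qed
  then have "\<exists>!a. (\<forall>c. c \<notin> C \<longrightarrow> a c = 0) \<and> u - (\<Sum>c\<in>C. a c *\<^sub>R c) \<in> {0}" if "u \<in> span C" for u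
    using eq[OF that] by (intro ex1I[of _ "representation C u"]) (auto dest: representation_ne_zero)
  then have C': "basis_mod C (span C) {0}"
    using fin by (auto simp: basis_mod_def span_base)
  have "coord_mod C {0} u = representation C u" if "u \<in> span C" for u
    using that eq by (intro coord_mod_unique[OF C']) (auto dest: representation_ne_zero)
  moreover have "quotient_trace f (span C) {0} = (\<Sum>c\<in>C. coord_mod C {0} (f c) c)"
    using linear_0[OF f(1)] f by (intro quotient_trace_eq[OF C']) auto
  ultimately show ?thesis
    using f(2) by (auto simp: span_base image_subset_iff intro!: sum.cong)
qed

lemma span_pairE:
  assumes "y \<in> span {u, v}"
  obtains s t where "y = s *\<^sub>R u + t *\<^sub>R v"
  using assms that by (auto simp: span_breakdown_eq span_singleton) (metis add.commute diff_add_cancel)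

text \<open>This is the complex Heisenberg algebra viewed over the reals: \<open>de5 + i de6\<close>
  is the wedge product of \<open>e1 + i e2\<close> and \<open>e3 + i e4\<close>. This explains why
  \<open>D\<close> acts on the centre by a complex number.\<close>

lemma no_exact_G2_n2:
  fixes br :: "'n::euclidean_space \<Rightarrow> 'n \<Rightarrow> 'n"
  assumes der: "derivation br D" and "is_n2 br" and su: "strongly_unimodular (semidirect br D)"
    and \<alpha>: "alternating_form 2 \<alpha>"
  shows "\<not> G2_structure (ce_d (semidirect br D) \<alpha>)"
proof -
  have D: "linear D" and leibniz: "\<And>x y. D (br x y) = br (D x) y + br x (D y)"
    using der by (auto simp: derivation_def)
  obtain b e where lie: "lie_algebra br" and dual: "dual_bases 6 b e"
    and de: "\<forall>i\<in>{1..4}. ce_d br (e i) = (\<lambda>_. 0)"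
    and de5: "ce_d br (e 5) = (\<lambda>vs. wedge 1 1 (e 1) (e 3) vs - wedge 1 1 (e 2) (e 4) vs)"
    and de6: "ce_d br (e 6) = (\<lambda>vs. wedge 1 1 (e 1) (e 4) vs + wedge 1 1 (e 2) (e 3) vs)"
    using assms(2) by (auto simp: is_n2_def)
  have br: "br x y = - ((e 1 [x] * e 3 [y] - e 1 [y] * e 3 [x] - (e 2 [x] * e 4 [y] - e 2 [y] * e 4 [x])) *\<^sub>R b 5)
      - (e 1 [x] * e 4 [y] - e 1 [y] * e 4 [x] + (e 2 [x] * e 3 [y] - e 2 [y] * e 3 [x])) *\<^sub>R b 6" for x y
    using dual_bases_bracket[OF dual de, of x y] unfolding de5 de6 wedge_1_1 .
  have eb: "e i [b j] = (if i = j then 1 else 0)" if "i \<in> {1..6}" "j \<in> {1..6}" for i j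
    using dual that by (auto simp: dual_bases_def)
  have e: "linear (\<lambda>x. e i [x])" if "i \<in> {1..6}" for i
    using dual that by (intro alternating_form_1_linear) (auto simp: dual_bases_def)
  note e_simps = linear_add[OF e] linear_cmul[OF e] linear_0[OF e] linear_diff[OF e] linear_neg[OF e] eb
  have central: "br (b 5) z = 0" "br (b 6) z = 0" "br z (b 5) = 0" "br z (b 6) = 0" for z
    by (simp_all add: br e_simps)
  have br13: "br (b 1) (b 3) = - b 5" and br24: "br (b 2) (b 4) = b 5"
    and br14: "br (b 1) (b 4) = - b 6" and br23: "br (b 2) (b 3) = - b 6"
    by (simp_all add: br e_simps)
  define p q where "p = e 5 [D (b 5)]" and "q = e 6 [D (b 5)]"
  define A where "A i j = e i [D (b j)]" for i j
  \<comment> \<open>Each of \<open>b 5\<close> and \<open>b 6\<close> is, up to sign, a bracket of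
    basis vectors in two ways. The Leibniz rule therefore gives two expressions for each of
    \<open>D (b 5)\<close> and \<open>D (b 6)\<close>, which are compared below.\<close>
  have "D (b 5) = - (br (D (b 1)) (b 3) + br (b 1) (D (b 3)))"
    using leibniz[of "b 1" "b 3"] by (simp add: br13 linear_neg[OF D] minus_equation_iff[of "D _"] del: One_nat_def)
  then have D5: "D (b 5) = (A 1 1 + A 3 3) *\<^sub>R b 5 + (A 2 1 + A 4 3) *\<^sub>R b 6"
    by (simp add: br[of "D (b 1)" "b 3"] br[of "b 1" "D (b 3)"] e_simps A_def algebra_simps del: One_nat_def)
  have "D (b 5) = (br (D (b 2)) (b 4) + br (b 2) (D (b 4)))"
    using leibniz[of "b 2" "b 4"] by (simp add: br24 linear_neg[OF D] minus_equation_iff[of "D _"] del: One_nat_def)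
  then have D5': "D (b 5) = (A 2 2 + A 4 4) *\<^sub>R b 5 - (A 1 2 + A 3 4) *\<^sub>R b 6"
    by (simp add: br[of "D (b 2)" "b 4"] br[of "b 2" "D (b 4)"] e_simps A_def algebra_simps del: One_nat_def)
  have "D (b 6) = - (br (D (b 1)) (b 4) + br (b 1) (D (b 4)))"
    using leibniz[of "b 1" "b 4"] by (simp add: br14 linear_neg[OF D] minus_equation_iff[of "D _"] del: One_nat_def)
  then have D6: "D (b 6) = (A 3 4 - A 2 1) *\<^sub>R b 5 + (A 1 1 + A 4 4) *\<^sub>R b 6"
    by (simp add: br[of "D (b 1)" "b 4"] br[of "b 1" "D (b 4)"] e_simps A_def algebra_simps del: One_nat_def)
  have "D (b 6) = - (br (D (b 2)) (b 3) + br (b 2) (D (b 3)))"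
    using leibniz[of "b 2" "b 3"] by (simp add: br23 linear_neg[OF D] minus_equation_iff[of "D _"] del: One_nat_def)
  then have D6': "D (b 6) = (A 1 2 - A 4 3) *\<^sub>R b 5 + (A 2 2 + A 3 3) *\<^sub>R b 6"
    by (simp add: br[of "D (b 2)" "b 3"] br[of "b 2" "D (b 3)"] e_simps A_def algebra_simps del: One_nat_def)
  have coeffs: "A 1 1 + A 3 3 = p" "A 2 1 + A 4 3 = q" "A 2 2 + A 4 4 = p" "A 1 2 + A 3 4 = - q"
    using arg_cong[OF D5, of "\<lambda>v. e 5 [v]"] arg_cong[OF D5, of "\<lambda>v. e 6 [v]"]
      arg_cong[OF D5', of "\<lambda>v. e 5 [v]"] arg_cong[OF D5', of "\<lambda>v. e 6 [v]"]
    by (simp_all add: e_simps p_def q_def)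
  have "A 3 4 - A 2 1 = A 1 2 - A 4 3" "A 1 1 + A 4 4 = A 2 2 + A 3 3"
    using arg_cong[OF D6[unfolded D6'], of "\<lambda>v. e 5 [v]"] arg_cong[OF D6[unfolded D6'], of "\<lambda>v. e 6 [v]"]
    by (simp_all add: e_simps)
  \<comment> \<open>By \<open>coeffs\<close> the two sides of the first equation add up to
    \<open>-2q\<close> and those of the second to \<open>2p\<close>; being equal, they are
    \<open>-q\<close> and \<open>p\<close>.\<close>
  then have "A 3 4 - A 2 1 = - q" "A 1 1 + A 4 4 = p" using coeffs by linarith+
  then have D5: "D (b 5) = p *\<^sub>R b 5 + q *\<^sub>R b 6" and D6: "D (b 6) = - q *\<^sub>R b 5 + p *\<^sub>R b 6"
    using D5 D6 coeffs by simp_all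
  have indep: "independent {b 5, b 6}" and "b 5 \<noteq> b 6"
  proof -
    show "independent {b 5, b 6}"
      by (rule independent_mono[of "b ` {1..6}"]) (use dual in \<open>auto simp: dual_bases_def\<close>)
    show "b 5 \<noteq> b 6" using eb[of 5 5] eb[of 5 6] by auto
  qed
  have L1: "lower_central br UNIV 1 = span {b 5, b 6}"
  proof -
    have "br x y \<in> span {b 5, b 6}" for x y
      unfolding br[of x y] by (intro span_diff span_neg span_mul span_base) auto
    then have "{br x y |x y. x \<in> UNIV \<and> y \<in> UNIV} \<subseteq> span {b 5, b 6}" by auto
    moreover have "{b 5, b 6} \<subseteq> span {br x y |x y. x \<in> UNIV \<and> y \<in> UNIV}"
    proof -
      have "br (b 2) (b 4) \<in> span {br x y |x y. x \<in> UNIV \<and> y \<in> UNIV}"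
        "- br (b 1) (b 4) \<in> span {br x y |x y. x \<in> UNIV \<and> y \<in> UNIV}"
        by (rule span_base, blast) (rule span_neg, rule span_base, blast)
      then show ?thesis by (simp add: br24 br14 del: One_nat_def)
    qed
    ultimately show ?thesis
      by (simp add: bracket_span_def) (simp add: span_eq)
  qed
  have bil: "bilinear br" using lie by (simp add: lie_algebra_def)
  have L2: "lower_central br UNIV 2 = {0}"
  proof -
    have "br x y = 0" if y: "y \<in> span {b 5, b 6}" for x y
    proof -
      obtain s t where "y = s *\<^sub>R b 5 + t *\<^sub>R b 6"
        using span_pairE[OF y] .
      then show ?thesis
        by (simp add: bilinear_radd[OF bil] bilinear_rmul[OF bil] central)
    qed
    moreover have "0 \<in> span {b 5, b 6}" by (rule span_zero)
    ultimately have "{br x y |x y. x \<in> UNIV \<and> y \<in> span {b 5, b 6}} = {0}" by force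
    then show ?thesis
      using L1 by (simp add: numeral_2_eq_2 bracket_span_def)
  qed
  have "p = 0"
  proof (rule strongly_unimodular_cases[OF su bil D])
    show "\<exists>k. lower_central br UNIV k = {0}" using L2 by blast
  next
    \<comment> \<open>The instance \<open>i = 1\<close> is decisive: its quotient is the span of
      \<open>b 5\<close> and \<open>b 6\<close> modulo 0, on which both diagonal entries of
      \<open>D\<close> are \<open>p\<close>.\<close>
    assume tr: "\<And>i. quotient_trace (semidirect br D (0, 1)) (lower_central br UNIV i \<times> {0})
      (lower_central br UNIV (Suc i) \<times> {0}) = 0"
    let ?f = "semidirect br D (0, 1)"
    let ?C = "{(b 5, 0::real), (b 6, 0)}"
    have lin0: "linear (\<lambda>v::'n. (v, 0::real))" by (rule linearI) auto
    have C: "independent ?C"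
      using linear_independent_injective_image[OF lin0 indep] by (simp add: inj_on_def)
    have "span {b 5, b 6} \<times> {0} = (\<lambda>v. (v, 0::real)) ` span {b 5, b 6}" by auto
    also have "\<dots> = span ?C" using linear_span_image[OF lin0, of "{b 5, b 6}"] by simp
    finally have U: "span {b 5, b 6} \<times> {0} = span ?C" .
    have f5: "?f (b 5, 0) = p *\<^sub>R (b 5, 0) + q *\<^sub>R (b 6, 0)"
      and f6: "?f (b 6, 0) = - q *\<^sub>R (b 5, 0) + p *\<^sub>R (b 6, 0)"
      using D5 D6 by (simp_all add: semidirect_def bilinear_lzero[OF bil])
    have f: "linear ?f"
      using lie_algebra_semidirect[OF lie der] by (auto simp: lie_algebra_def bilinear_def)
    have c: "(b 5, 0) \<in> span ?C" "(b 6, 0) \<in> span ?C" by (auto intro: span_base)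
    have "?f ` ?C \<subseteq> span ?C"
      unfolding image_insert f5 f6 by (auto intro!: span_add span_diff span_neg span_mul c simp del: scaleR_Pair)
    then have "?f ` span ?C \<subseteq> span ?C"
      unfolding linear_span_image[OF f, symmetric] by (rule span_minimal) simp
    then have "quotient_trace ?f (span ?C) {0} = (\<Sum>c\<in>?C. representation ?C (?f c) c)"
      by (rule quotient_trace_span[OF C f])
    also have "\<dots> = p + p"
      using \<open>b 5 \<noteq> b 6\<close> c
      by (simp add: f5 f6 representation_add[OF C] representation_scale[OF C] representation_basis[OF C]
          span_mul span_neg del: scaleR_Pair scaleR_minus_left add_Pair)
    finally have "quotient_trace ?f (span ?C) {0} = p + p" .
    moreover have "{0} \<times> {0} = {0 :: 'n \<times> real}" by (auto simp: zero_prod_def)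
    ultimately show "p = 0" using tr[of 1] unfolding Suc_1 L1 L2 U by simp
  next
    fix k assume nil: "\<And>x. (D ^^ k) x = 0"
    \<comment> \<open>On the centre \<open>D\<close> is multiplication by the complex number \<open>p + iq\<close>.\<close>
    define N where "N v = (e 5 [v])\<^sup>2 + (e 6 [v])\<^sup>2" for v
    \<comment> \<open>\<open>N\<close> is the squared modulus on the centre, so each application of
      \<open>D\<close> multiplies it by that of \<open>p + iq\<close>, starting from 1 at
      \<open>b 5\<close>.\<close>
    have "(D ^^ k) (b 5) \<in> span {b 5, b 6} \<and> N ((D ^^ k) (b 5)) = (p\<^sup>2 + q\<^sup>2) ^ k" for k
    proof (induction k)
      case 0
      then show ?case by (simp add: N_def eb span_base)
    next
      case (Suc k)
      then obtain s t where st: "(D ^^ k) (b 5) = s *\<^sub>R b 5 + t *\<^sub>R b 6"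
        by (auto elim: span_pairE)
      have "(D ^^ Suc k) (b 5) = (p * s - q * t) *\<^sub>R b 5 + (q * s + p * t) *\<^sub>R b 6"
        by (simp add: st linear_add[OF D] linear_cmul[OF D] D5 D6 algebra_simps)
      moreover have "s\<^sup>2 + t\<^sup>2 = (p\<^sup>2 + q\<^sup>2) ^ k"
        using Suc by (simp add: st N_def e_simps)
      moreover have "(p * s - q * t)\<^sup>2 + (q * s + p * t)\<^sup>2 = (p\<^sup>2 + q\<^sup>2) * (s\<^sup>2 + t\<^sup>2)"
        by algebra
      moreover have "x *\<^sub>R b 5 + y *\<^sub>R b 6 \<in> span {b 5, b 6}" for x y
        by (intro span_add span_mul span_base) auto
      ultimately show ?case by (simp add: N_def e_simps)
    qed
    from this[of k] have "(p\<^sup>2 + q\<^sup>2) ^ k = 0"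
      by (simp add: nil N_def e_simps)
    then show "p = 0" by (simp add: sum_power2_eq_zero_iff)
  qed
  note \<alpha>s = alternating_form_2[OF \<alpha>]
  show ?thesis
  proof (rule not_G2_structureI[OF \<alpha> D, of "b 5" "b 6"])
    show "s = 0 \<and> t = 0" if eq: "s *\<^sub>R b 5 + t *\<^sub>R b 6 = 0" for s t
      using arg_cong[OF eq, of "\<lambda>v. e 5 [v]"] arg_cong[OF eq, of "\<lambda>v. e 6 [v]"] by (simp add: e_simps)
    \<comment> \<open>With \<open>p = 0\<close>, \<open>D\<close> maps \<open>b 5\<close> to a
      multiple of \<open>b 6\<close> and \<open>b 6\<close> to one of \<open>b 5\<close>, so both
      sides vanish by alternation.\<close>
    show "\<alpha> [(D (b 5), 0), (b 6, 0)] = \<alpha> [(D (b 6), 0), (b 5, 0)]"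
      using linear_cmul[OF \<alpha>s(1), of q "(b 6, 0)" "(b 6, 0)"] linear_cmul[OF \<alpha>s(1), of "- q" "(b 5, 0)" "(b 5, 0)"]
      by (simp add: D5 D6 \<open>p = 0\<close> \<alpha>s(3))
  qed (simp_all add: central linear_0[OF \<alpha>s(1)] flip: zero_prod_def)
qed

theorem theorem2p4:
  fixes br :: "'n::euclidean_space \<Rightarrow> 'n \<Rightarrow> 'n" and D :: "'n \<Rightarrow> 'n"
  assumes "DIM('n) = 6" and "lie_algebra br" and "derivation br D"
  shows "(abelian br \<or> is_n1 br \<longrightarrow>
            (\<nexists>\<phi>. exact_G2_structure (semidirect br D) \<phi>)) \<and>
         (is_n2 br \<and> strongly_unimodular (semidirect br D) \<longrightarrow>
            (\<nexists>\<phi>. exact_G2_structure (semidirect br D) \<phi>))"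
proof -
  have "linear D" using assms(3) by (simp add: derivation_def)
  then show ?thesis
    using assms no_exact_G2_abelian[of D br] no_exact_G2_n1[of D br] no_exact_G2_n2[of br D]
    by (auto simp: exact_G2_structure_def)
qed

end
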